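(* Let $m,n$ be integers with $2\le m\le 4$ and $n>1$, and let $G$ be a finite $\mathcal{T}(m,n)$-group such that $\gcd(p,|G|)=1$ for every prime number $p\le n$. Then $G$ is abelian.
   Context: For integers $m\ge 2$ and $n\ge 1$, a group $G$ is called a $\mathcal{T}(m,n)$-group if for every $m$ subsets $X_1,\dots,X_m$ of $G$, each of cardinality $n$, there exist indices $i\ne j$ and elements $x_i\in X_i$, $x_j\in X_j$ such that $x_ix_j=x_jx_i$. *)

theory Defs
  imports "HOL-Algebra.Algebra" "HOL-Computational_Algebra.Primes"
begin

(* The m subsets are A 0, ..., A (m - 1); coincidences among them are allowed,
   but a family with a repeated (nonempty) set satisfies the condition trivially.
   The notion is intended for m \<ge> 2 and n \<ge> 1, where card (A i) = n makes A i finite. *)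
definition T_group :: "nat \<Rightarrow> nat \<Rightarrow> ('a, 'b) monoid_scheme \<Rightarrow> bool" where
  "T_group m n G \<longleftrightarrow>
     group G \<and>
     (\<forall>A :: nat \<Rightarrow> 'a set.
        (\<forall>i<m. A i \<subseteq> carrier G \<and> card (A i) = n) \<longrightarrow>
        (\<exists>i<m. \<exists>j<m. i \<noteq> j \<and>
           (\<exists>x\<in>A i. \<exists>y\<in>A j. x \<otimes>\<^bsub>G\<^esub> y = y \<otimes>\<^bsub>G\<^esub> x)))"

end

theory Submission
  imports Defs "HOL-Number_Theory.Cong"
begin

text \<open>
  If every prime divisor of the group order exceeds \<open>n\<close>, then the powers \<open>x\<close>, \dots, \<open>x\<^sup>n\<close> of an
  element \<open>x \<noteq> 1\<close> are distinct and generate the same subgroup, so they have the same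
  centralizer as \<open>x\<close>.  Hence pairwise non-commuting elements \<open>c\<^sub>1\<close>, \dots, \<open>c\<^sub>m\<close>
  yield sets of powers violating the \<open>T(m,n)\<close> condition.  If \<open>x\<close> and \<open>y\<close> do not
  commute, then, the order being odd, \<open>x\<close>, \<open>y\<close>, \<open>xy\<close>, \<open>xy\<^sup>2\<close> are four such elements.
\<close>

text \<open>A common prime divisor of \<open>k\<close> and \<open>N\<close> would be at most
  \<open>k\<close>, hence at most \<open>n\<close>. This turns the hypothesis on primes into one on
  exponents.\<close>

lemma coprime_if_prime_divisors_coprime:
  fixes k N n :: nat
  assumes "\<And>p. Factorial_Ring.prime p \<Longrightarrow> p \<le> n \<Longrightarrow> gcd p N = 1" and "0 < k" and "k \<le> n"
  shows "coprime k N"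
proof (rule ccontr)
  assume "\<not> coprime k N"
  then obtain p where p: "Factorial_Ring.prime p" "p dvd k" "p dvd N"
    using prime_factor_nat[of "gcd k N"] by (auto simp: coprime_iff_gcd_eq_1)
  have "p \<le> n"
    using p(2) assms(2,3) dvd_imp_le order_trans by blast
  then have "gcd p N = 1" by (rule assms(1)[OF p(1)])
  with p(3) have "p = 1" by (simp add: gcd_nat.absorb1)
  with p(1) show False by simp
qed

context group
begin

text \<open>An exponent coprime to the order is invertible modulo it, so \<open>x\<close> is a power
  of \<open>x [^] k\<close> and \<open>y\<close> one of \<open>y [^] l\<close>; powers of commuting
  elements commute.\<close>

lemma commutes_if_pow_commutes_pow:
  assumes "finite (carrier G)" and "coprime k (order G)" and "coprime l (order G)"
    and "x \<in> carrier G" and "y \<in> carrier G"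
    and "x [^] k \<otimes> y [^] l = y [^] l \<otimes> x [^] k"
  shows "x \<otimes> y = y \<otimes> x"
proof -
  have root: "\<exists>j::nat. (z [^] i) [^] j = z"
    if i: "coprime i (order G)" and z: "z \<in> carrier G" for i :: nat and z
  proof -
    obtain j where "[i * j = Suc 0] (mod order G)"
      using cong_solve_coprime_nat[OF i] by blast
    \<comment> \<open>Over the naturals a congruence adds multiples of the modulus on both sides; in
      the exponent both vanish.\<close>
    then obtain q r where "Suc 0 + q * order G = i * j + r * order G"
      unfolding cong_iff_lin_nat by blast
    moreover have "z [^] (q * order G) = \<one>" for q
      using z pow_order_eq_1[of z] nat_pow_pow[of z "order G" q] by (simp add: mult.commute)
    moreover have "z [^] (i * j + r * order G) = z [^] (i * j) \<otimes> z [^] (r * order G)"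
      and "z [^] (Suc 0 + q * order G) = z [^] Suc 0 \<otimes> z [^] (q * order G)"
      using z by (simp_all only: nat_pow_mult)
    ultimately have "z [^] (i * j) = z"
      using z by simp
    then show ?thesis using z by (metis nat_pow_pow)
  qed
  obtain i j :: nat where "(x [^] k) [^] i = x" and "(y [^] l) [^] j = y"
    using root[OF assms(2,4)] root[OF assms(3,5)] by blast
  then have "x \<otimes> y [^] l = y [^] l \<otimes> x"
    using group_commutes_pow[OF assms(6), of i] assms(4,5) by simp
  from group_commutes_pow[OF this[symmetric], of j] show ?thesis
    using \<open>(y [^] l) [^] j = y\<close> assms(4,5) by simp
qed

text \<open>If two powers agree, \<open>ord x\<close> divides both the difference of the exponents
  and the group order, which are coprime.\<close>

lemma inj_on_pow_of_coprime:
  assumes "finite (carrier G)" and "x \<in> carrier G" and "x \<noteq> \<one>"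
    and "\<And>k. 0 < k \<Longrightarrow> k \<le> n \<Longrightarrow> coprime k (order G)"
  shows "inj_on (\<lambda>k. x [^] k) {1..n}"
proof (rule linorder_inj_onI)
  fix i j :: nat
  assume ij: "i < j" "i \<in> {1..n}" "j \<in> {1..n}"
  show "x [^] i \<noteq> x [^] j"
  proof
    assume "x [^] i = x [^] j"
    then have "x [^] (j - i) = \<one>"
      using pow_eq_div2 assms(2) by metis
    then have "ord x dvd j - i" and "ord x dvd order G"
      using assms(1,2) by (auto simp: pow_eq_id ord_dvd_group_order)
    moreover have "coprime (j - i) (order G)"
      using assms(4)[of "j - i"] ij by auto
    ultimately have "ord x = 1"
      using coprime_common_divisor_nat by blast
    then show False using assms(2,3) ord_eq_1 by blast
  qed
qed auto

lemma four_pairwise_noncommuting: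
  assumes "finite (carrier G)" and "coprime 2 (order G)"
    and x: "x \<in> carrier G" and y: "y \<in> carrier G" and xy: "x \<otimes> y \<noteq> y \<otimes> x"
  obtains c :: "nat \<Rightarrow> 'a" where "\<And>i. i < 4 \<Longrightarrow> c i \<in> carrier G"
    and "\<And>i j. i < 4 \<Longrightarrow> j < 4 \<Longrightarrow> i \<noteq> j \<Longrightarrow> c i \<otimes> c j \<noteq> c j \<otimes> c i"
proof
  define cs where "cs = [x, y, x \<otimes> y, x \<otimes> (y \<otimes> y)]"
  \<comment> \<open>Odd order enters here: commuting with the square of \<open>y\<close> would force
    commuting with \<open>y\<close>.\<close>
  have sq: "x \<otimes> (y \<otimes> y) \<noteq> y \<otimes> (y \<otimes> x)"
    using commutes_if_pow_commutes_pow[of 1 2 x y] assms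
    by (auto simp: m_assoc numeral_2_eq_2)
  have xyr: "x \<otimes> (y \<otimes> b) \<noteq> y \<otimes> (x \<otimes> b)" if "b \<in> carrier G" for b
    using that x y xy by (metis m_assoc m_closed r_cancel)
  \<comment> \<open>One inequality for each pair other than (\<open>x\<close>, \<open>y\<close>),
    nested to the right as \<open>m_assoc\<close> leaves it. After cancellation only the third needs
    \<open>sq\<close>; the others reduce to \<open>xy\<close>.\<close>
  have nc: "x \<otimes> (y \<otimes> (x \<otimes> (y \<otimes> y))) \<noteq> x \<otimes> (y \<otimes> (y \<otimes> (x \<otimes> y)))"
    "x \<otimes> (x \<otimes> y) \<noteq> x \<otimes> (y \<otimes> x)"
    "x \<otimes> (x \<otimes> (y \<otimes> y)) \<noteq> x \<otimes> (y \<otimes> (y \<otimes> x))"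
    "x \<otimes> (y \<otimes> y) \<noteq> y \<otimes> (x \<otimes> y)"
    "x \<otimes> (y \<otimes> (y \<otimes> y)) \<noteq> y \<otimes> (x \<otimes> (y \<otimes> y))"
    using x y xy sq xyr by simp_all
  show "cs ! i \<otimes> cs ! j \<noteq> cs ! j \<otimes> cs ! i" if "i < 4" "j < 4" "i \<noteq> j" for i j
  proof -
    have "i = 0 \<or> i = 1 \<or> i = 2 \<or> i = 3" "j = 0 \<or> j = 1 \<or> j = 2 \<or> j = 3"
      using that by auto
    with that(3) x y xy sq nc nc[THEN not_sym] xy[THEN not_sym] sq[THEN not_sym] show ?thesis
      unfolding cs_def by (elim disjE) (simp_all add: m_assoc)
  qed
  show "cs ! i \<in> carrier G" if "i < 4" for i
  proof -
    have "i \<in> {0, 1, 2, 3}" using that by auto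
    with x y show ?thesis unfolding cs_def by auto
  qed
qed

end

theorem theorem2p20:
  fixes G :: "('a, 'b) monoid_scheme" and m n :: nat
  assumes "2 \<le> m" and "m \<le> 4" and "1 < n"
    and "T_group m n G"
    and "finite (carrier G)"
    and "\<And>p::nat. Factorial_Ring.prime p \<Longrightarrow> p \<le> n \<Longrightarrow> gcd p (order G) = 1"
  shows "comm_group G"
proof -
  interpret group G using assms(4) by (simp add: T_group_def)
  have cop: "coprime k (order G)" if "0 < k" "k \<le> n" for k
    using coprime_if_prime_divisors_coprime assms(6) that by blast
  show ?thesis
  proof (rule group_comm_groupI, rule ccontr)
    fix x y assume "x \<in> carrier G" "y \<in> carrier G" "x \<otimes>\<^bsub>G\<^esub> y \<noteq> y \<otimes>\<^bsub>G\<^esub> x"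
    then obtain c :: "nat \<Rightarrow> 'a" where c: "\<And>i. i < 4 \<Longrightarrow> c i \<in> carrier G"
      and nc: "\<And>i j. i < 4 \<Longrightarrow> j < 4 \<Longrightarrow> i \<noteq> j \<Longrightarrow> c i \<otimes>\<^bsub>G\<^esub> c j \<noteq> c j \<otimes>\<^bsub>G\<^esub> c i"
      using four_pairwise_noncommuting[OF assms(5)] cop[of 2] assms(3) by auto
    \<comment> \<open>Exponent 0 is left out: it would put the identity into every set.\<close>
    define A where "A i = (\<lambda>k. c i [^]\<^bsub>G\<^esub> k) ` {1..n}" for i
    have "A i \<subseteq> carrier G \<and> card (A i) = n" if "i < m" for i
    proof -
      have i: "i < 4" using that assms(2) by simp
      \<comment> \<open>Any other index will do: failing to commute with \<open>c j\<close> shows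
        that \<open>c i\<close> is not the identity.\<close>
      obtain j :: nat where "j < 4" and "j \<noteq> i"
        by (cases "i = 0") (auto intro: that[of 0] that[of 1])
      then have "c i \<noteq> \<one>\<^bsub>G\<^esub>"
        using nc[of i j] c[of j] i by auto
      then have "inj_on (\<lambda>k. c i [^]\<^bsub>G\<^esub> k) {1..n}"
        using inj_on_pow_of_coprime[OF assms(5) c[OF i]] cop by blast
      then show ?thesis using c[OF i] by (auto simp: A_def card_image)
    qed
    then have "\<exists>i<m. \<exists>j<m. i \<noteq> j \<and> (\<exists>x\<in>A i. \<exists>y\<in>A j. x \<otimes>\<^bsub>G\<^esub> y = y \<otimes>\<^bsub>G\<^esub> x)"
      using assms(4) by (simp add: T_group_def)
    then obtain i j k l where ij: "i < m" "j < m" "i \<noteq> j"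
      and "k \<in> {1..n}" "l \<in> {1..n}"
      and "c i [^]\<^bsub>G\<^esub> k \<otimes>\<^bsub>G\<^esub> c j [^]\<^bsub>G\<^esub> l = c j [^]\<^bsub>G\<^esub> l \<otimes>\<^bsub>G\<^esub> c i [^]\<^bsub>G\<^esub> k"
      by (auto simp: A_def)
    moreover from this have "coprime k (order G)" "coprime l (order G)"
      using cop by simp_all
    ultimately have "c i \<otimes>\<^bsub>G\<^esub> c j = c j \<otimes>\<^bsub>G\<^esub> c i"
      using commutes_if_pow_commutes_pow[OF assms(5), of k l "c i" "c j"] c assms(2) by simp
    then show False using nc ij assms(2) by simp
  qed
qed

end
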